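(* Let $\ell\ge 8$ and let $\vec C$ be an orientation of the cycle $C_\ell$. If $G$ is a graph with $m(G)<m_2(\vec C)$, then $G\not\to\vec C$, i.e., $G$ has an orientation containing no copy of $\vec C$.
   Context: $m(G)=\max\{e(J)/v(J):J\subseteq G,\ v(J)\ge1\}$ and $m_2(G)=\max\{(e(J)-1)/(v(J)-2):J\subseteq G,\ v(J)\ge3\}$, densities of oriented graphs being those of their underlying graphs (so $m_2(\vec C)=(\ell-1)/(\ell-2)$). *)

theory Defs
  imports Complex_Main "Graph_Theory.Graph_Theory"
begin

text \<open>
  A finite simple graph is a \<^locale>\<open>pair_graph\<close>, i.e. a symmetric loop-free digraph in which
  each edge \<open>{u, v}\<close> is represented by the two arcs \<open>(u, v)\<close> and \<open>(v, u)\<close>; \<open>edges\<close> recovers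
  the set of unordered edges, so that \<open>e(G) = card (edges G)\<close>.
  An oriented graph is a \<^locale>\<open>pair_digraph\<close> without antiparallel arcs; its underlying graph
  is its symmetric closure \<^const>\<open>mk_symmetric\<close>.
\<close>

definition edges :: "'a pair_pre_digraph \<Rightarrow> 'a set set" where
  "edges G = {{u, v} | u v. (u, v) \<in> parcs G}"

definition subgraphs :: "'a pair_pre_digraph \<Rightarrow> 'a pair_pre_digraph set" where
  "subgraphs G = {J. pair_graph J \<and> subgraph (with_proj J) (with_proj G)}"

text \<open>
  For a finite graph the sets below are finite. The first is nonempty iff \<open>G\<close> has a vertex, the
  second iff \<open>G\<close> has at least three vertices; otherwise the maximum is an unspecified real.
\<close>

definition max_density :: "'a pair_pre_digraph \<Rightarrow> real" where
  "max_density G = Max {real (card (edges J)) / real (card (pverts J)) | J.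
     J \<in> subgraphs G \<and> card (pverts J) \<ge> 1}"

definition max_2_density :: "'a pair_pre_digraph \<Rightarrow> real" where
  "max_2_density G = Max {(real (card (edges J)) - 1) / (real (card (pverts J)) - 2) | J.
     J \<in> subgraphs G \<and> card (pverts J) \<ge> 3}"

definition oriented_graph :: "'a pair_pre_digraph \<Rightarrow> bool" where
  "oriented_graph D \<longleftrightarrow> pair_digraph D \<and> (\<forall>u v. (u, v) \<in> parcs D \<longrightarrow> (v, u) \<notin> parcs D)"

definition orientation_of :: "'a pair_pre_digraph \<Rightarrow> 'a pair_pre_digraph \<Rightarrow> bool" where
  "orientation_of D G \<longleftrightarrow> oriented_graph D \<and> mk_symmetric (with_proj D) = G"

definition contains_copy :: "'a pair_pre_digraph \<Rightarrow> 'b pair_pre_digraph \<Rightarrow> bool" where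
  "contains_copy D H \<longleftrightarrow>
     (\<exists>K. subgraph (with_proj K) (with_proj D) \<and> digraph_iso (with_proj H) (with_proj K))"

definition arrows :: "'a pair_pre_digraph \<Rightarrow> 'b pair_pre_digraph \<Rightarrow> bool" where
  "arrows G H \<longleftrightarrow> (\<forall>D. orientation_of D G \<longrightarrow> contains_copy D H)"

definition cycle_graph :: "nat \<Rightarrow> nat pair_pre_digraph" where
  "cycle_graph l = \<lparr> pverts = {..<l},
     parcs = (\<Union>i<l. {(i, Suc i mod l), (Suc i mod l, i)}) \<rparr>"

lemma pair_graph_cycle_graph:
  assumes "l \<ge> 3"
  shows "pair_graph (cycle_graph l)"
proof -
  have "Suc i mod l \<noteq> i" if "i < l" for i
    using that assms by (cases "Suc i = l") auto
  then have loop: "(i, i) \<notin> parcs (cycle_graph l)" for i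
    by (fastforce simp: cycle_graph_def)
  have arc: "u < l \<and> v < l \<and> (v, u) \<in> parcs (cycle_graph l)"
    if "(u, v) \<in> parcs (cycle_graph l)" for u v
    using that assms by (auto simp: cycle_graph_def)
  have fin: "finite (parcs (cycle_graph l))"
    by (simp add: cycle_graph_def)
  have verts: "pverts (cycle_graph l) = {..<l}"
    by (simp add: cycle_graph_def)
  show ?thesis
  proof
    show "symmetric (with_proj (cycle_graph l))"
      using arc by (auto simp: symmetric_def sym_def arcs_ends_def arc_to_ends_def)
  qed (use arc loop fin verts in \<open>auto simp: prod_eq_iff\<close>)
qed

text \<open>The arc map of the isomorphism is determined by its vertex map, so copies are exactly the
  injective homomorphic images.\<close>

lemma contains_copy_iff:
  assumes D: "pair_wf_digraph D" and H: "pair_wf_digraph H"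
  shows "contains_copy D H \<longleftrightarrow>
    (\<exists>f. inj_on f (pverts H) \<and> f ` pverts H \<subseteq> pverts D \<and>
         (\<forall>(u, v) \<in> parcs H. (f u, f v) \<in> parcs D))"
proof
  assume "contains_copy D H"
  then obtain K h where K: "subgraph (with_proj K) (with_proj D)"
    and h: "pre_digraph.digraph_isomorphism (with_proj H) h"
    and Kh: "with_proj K = app_iso h (with_proj H)"
    unfolding contains_copy_def digraph_iso_def by blast
  let ?f = "iso_verts h"
  have verts: "pverts K = ?f ` pverts H" and arcs: "parcs K = iso_arcs h ` parcs H"
    and th: "iso_tail h = fst" "iso_head h = snd"
    using Kh by (simp_all add: with_proj_def app_iso_def)
  have inj: "inj_on ?f (pverts H)"
    and a: "\<And>e. e \<in> parcs H \<Longrightarrow> iso_arcs h e = (?f (fst e), ?f (snd e))"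
    using h th by (auto simp: pre_digraph.digraph_isomorphism_def prod_eq_iff)
  have sub: "pverts K \<subseteq> pverts D" "parcs K \<subseteq> parcs D"
    using K by (auto simp: subgraph_def)
  show "\<exists>f. inj_on f (pverts H) \<and> f ` pverts H \<subseteq> pverts D \<and>
         (\<forall>(u, v) \<in> parcs H. (f u, f v) \<in> parcs D)"
  proof (intro exI conjI ballI)
    show "inj_on ?f (pverts H)" "?f ` pverts H \<subseteq> pverts D"
      using inj verts sub by auto
    show "case e of (u, v) \<Rightarrow> (?f u, ?f v) \<in> parcs D" if "e \<in> parcs H" for e
      using a[OF that] that arcs sub(2) by (auto split: prod.split)
  qed
next
  assume "\<exists>f. inj_on f (pverts H) \<and> f ` pverts H \<subseteq> pverts D \<and>
         (\<forall>(u, v) \<in> parcs H. (f u, f v) \<in> parcs D)"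
  then obtain f where f: "inj_on f (pverts H)" "f ` pverts H \<subseteq> pverts D"
    "\<And>u v. (u, v) \<in> parcs H \<Longrightarrow> (f u, f v) \<in> parcs D"
    by (auto simp: Ball_def)
  interpret D: pair_wf_digraph D by fact
  interpret H: pair_wf_digraph H by fact
  define K where "K = \<lparr> pverts = f ` pverts H, parcs = map_prod f f ` parcs H \<rparr>"
  define h where "h = \<lparr> iso_verts = f, iso_arcs = map_prod f f, iso_head = snd, iso_tail = fst \<rparr>"
  have K: "pair_wf_digraph K"
    unfolding K_def by unfold_locales (auto dest: H.arc_fst_in_verts H.arc_snd_in_verts)
  then interpret K: pair_wf_digraph K .
  have "subgraph (with_proj K) (with_proj D)"
    using f D.wf_digraph_axioms K.wf_digraph_axioms
    by (auto simp: subgraph_def compatible_def K_def with_proj_def)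
  moreover have "inj_on (map_prod f f) (parcs H)"
    by (rule inj_on_subset[OF map_prod_inj_on[OF f(1) f(1)]])
      (auto dest: H.arc_fst_in_verts H.arc_snd_in_verts)
  then have "pre_digraph.digraph_isomorphism (with_proj H) h"
    using f(1) H.wf_digraph_axioms
    by (auto simp: pre_digraph.digraph_isomorphism_def h_def)
  moreover have "with_proj K = app_iso h (with_proj H)"
    by (simp add: K_def h_def app_iso_def with_proj_def)
  ultimately show "contains_copy D H"
    unfolding contains_copy_def digraph_iso_def by (intro exI conjI)
qed

end

theory Submission
  imports Defs
begin

text \<open>
  The density hypothesis gives \<open>e(J) < 7/6 v(J)\<close> for every nonempty subgraph \<open>J\<close> of \<open>G\<close>. Hence
  \<open>G\<close> is 2-degenerate, so it has a proper colouring with \<open>{0, 1, 2}\<close>; orienting every edge towards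
  the larger colour leaves no directed walk with three arcs, which settles the case that \<open>C\<close>
  contains such a walk. If \<open>C\<close> contains none, induct on the number of vertices: by a count of
  degrees, \<open>G\<close> has a vertex of degree at most one, which lies on no cycle, or two adjacent
  vertices \<open>a\<close>, \<open>b\<close> of degree two. In the latter case delete both and orient the path
  \<open>x a b y\<close> as a directed path; a copy of \<open>C\<close> through \<open>a\<close> or \<open>b\<close> would contain all of it.
\<close>

section \<open>Sparse arc sets and embeddings\<close>

definition nbrs :: "('a \<times> 'a) set \<Rightarrow> 'a set \<Rightarrow> 'a \<Rightarrow> 'a set" where
  "nbrs E W v = {w \<in> W. (v, w) \<in> E}"

text \<open>\<open>E\<close> holds both arcs of each edge, so this says \<open>e < 7/6 v\<close> for all induced subgraphs.\<close>

definition sparse_on :: "('a \<times> 'a) set \<Rightarrow> 'a set \<Rightarrow> bool" where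
  "sparse_on E V \<longleftrightarrow> (\<forall>W \<subseteq> V. W \<noteq> {} \<longrightarrow> 3 * card (E \<inter> W \<times> W) < 7 * card W)"

text \<open>Bare arc sets allow vertices to be deleted without rebuilding a graph. Injectivity is
  asked on \<open>Field C\<close> only, so for well-formed digraphs a copy in the sense of
  \<open>contains_copy\<close> yields an embedding, and refuting \<open>embeds\<close> excludes all
  copies.\<close>

definition embeds :: "('b \<times> 'b) set \<Rightarrow> ('a \<times> 'a) set \<Rightarrow> bool" where
  "embeds C D \<longleftrightarrow> (\<exists>f. inj_on f (Field C) \<and> (\<forall>(u, v) \<in> C. (f u, f v) \<in> D))"

lemma finite_nbrs: "finite W \<Longrightarrow> finite (nbrs E W v)"
  by (simp add: nbrs_def)

lemma sparse_on_subset: "sparse_on E V \<Longrightarrow> W \<subseteq> V \<Longrightarrow> sparse_on E W"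
  by (auto simp: sparse_on_def)

section \<open>Degree counting and three-colouring\<close>

lemma card_arcs_eq_sum_degrees:
  assumes "finite W"
  shows "card (E \<inter> W \<times> W) = (\<Sum>v\<in>W. card (nbrs E W v))"
proof -
  have "E \<inter> W \<times> W = (SIGMA v:W. nbrs E W v)"
    by (auto simp: nbrs_def)
  then show ?thesis
    using assms by (simp add: finite_nbrs)
qed

text \<open>Sparsity on \<open>V\<close> itself bounds the average degree strictly below 7/3, so not
  all degrees can reach 3.\<close>

lemma sparse_on_degree_le_2:
  assumes fin: "finite V" and "V \<noteq> {}" and sp: "sparse_on E V"
  shows "\<exists>v\<in>V. card (nbrs E V v) \<le> 2"
proof (rule ccontr)
  assume "\<not> ?thesis"
  then have "of_nat (card V) * 3 \<le> (\<Sum>v\<in>V. card (nbrs E V v))"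
    by (intro sum_bounded_below) force
  moreover have "3 * card (E \<inter> V \<times> V) < 7 * card V"
    using assms by (auto simp: sparse_on_def)
  ultimately show False
    by (simp add: card_arcs_eq_sum_degrees[OF fin])
qed

text \<open>Greedy colouring: remove a vertex of degree at most two, colour the rest by induction,
  and put the vertex back.\<close>

lemma sparse_on_three_colouring:
  assumes "finite V" "sym E" "irrefl E" "sparse_on E V"
  shows "\<exists>f :: 'a \<Rightarrow> nat. (\<forall>v. f v < 3) \<and> (\<forall>(u, v) \<in> E \<inter> V \<times> V. f u \<noteq> f v)"
  using assms
proof (induction V rule: finite_psubset_induct)
  case (psubset V)
  show ?case
  proof (cases "V = {}")
    case True
    then show ?thesis
      by (intro exI[of _ "\<lambda>_. 0"]) auto
  next
    case False
    then obtain v where v: "v \<in> V" "card (nbrs E V v) \<le> 2"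
      using sparse_on_degree_le_2[OF psubset.hyps _ psubset.prems(3)] by blast
    let ?W = "V - {v}"
    have "?W \<subset> V" "sparse_on E ?W"
      using v(1) psubset.prems(3) by (auto intro: sparse_on_subset)
    from psubset.IH[OF this(1) psubset.prems(1,2) this(2)]
    obtain f :: "'a \<Rightarrow> nat" where f: "\<And>w. f w < 3"
      "\<And>u w. (u, w) \<in> E \<Longrightarrow> u \<in> ?W \<Longrightarrow> w \<in> ?W \<Longrightarrow> f u \<noteq> f w"
      by blast
    \<comment> \<open>At most two of the three colours occur around \<open>v\<close>, so one is free
      for it.\<close>
    have "card (f ` nbrs E V v) < card {..<3 :: nat}"
      using card_image_le[OF finite_nbrs[OF \<open>finite V\<close>], of f E v] v by simp
    then have "\<not> {..<3} \<subseteq> f ` nbrs E V v"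
      using finite_nbrs[OF \<open>finite V\<close>] by (meson card_mono finite_imageI not_le)
    then obtain c where c: "c < 3" "\<And>w. w \<in> V \<Longrightarrow> (v, w) \<in> E \<Longrightarrow> f w \<noteq> c"
      by (auto simp: nbrs_def)
    let ?g = "f(v := c)"
    have "?g u \<noteq> ?g w" if uw: "(u, w) \<in> E" "u \<in> V" "w \<in> V" for u w
    proof -
      have "(w, u) \<in> E" "u \<noteq> w"
        using uw(1) \<open>sym E\<close> \<open>irrefl E\<close> by (auto simp: irrefl_def dest: symD)
      then show ?thesis
        using f(2)[of u w] c(2)[of u] c(2)[of w] uw by auto
    qed
    moreover have "?g w < 3" for w
      using f(1) c(1) by simp
    ultimately show ?thesis
      by (intro exI[of _ ?g]) blast
  qed
qed

section \<open>Reducible configurations and the inductive orientation\<close>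

lemma sparse_on_reducible:
  assumes fin: "finite V" and ne: "V \<noteq> {}" and "sym E" and sp: "sparse_on E V"
  shows "(\<exists>v\<in>V. card (nbrs E V v) \<le> 1) \<or>
    (\<exists>u\<in>V. \<exists>v\<in>V. (u, v) \<in> E \<and> card (nbrs E V u) = 2 \<and> card (nbrs E V v) = 2)"
proof (rule ccontr)
  let ?d = "\<lambda>v. card (nbrs E V v)"
  define A where "A = {v \<in> V. ?d v = 2}"
  define B where "B = {v \<in> V. ?d v \<ge> 3}"
  assume "\<not> ?thesis"
  \<comment> \<open>In a counterexample every vertex lies in \<open>A\<close> or \<open>B\<close>,
    and no edge joins two vertices of \<open>A\<close>.\<close>
  then have gt1: "\<forall>v\<in>V. \<not> ?d v \<le> 1" and indep: "\<And>u v. u \<in> A \<Longrightarrow> v \<in> A \<Longrightarrow> (u, v) \<notin> E"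
    unfolding A_def by blast+
  have "?d v = 2 \<or> ?d v \<ge> 3" if "v \<in> V" for v
    using bspec[OF gt1 that] by linarith
  then have V: "V = A \<union> B" "A \<inter> B = {}"
    by (auto simp: A_def B_def)
  have finAB: "finite A" "finite B"
    using fin by (simp_all add: A_def B_def)
  have dA: "(\<Sum>v\<in>A. ?d v) = 2 * card A"
    by (simp add: A_def)
  have dB: "card B * 3 \<le> (\<Sum>v\<in>B. ?d v)"
    using sum_bounded_below[of B 3 ?d] by (simp add: B_def)
  have "2 * card A = card (SIGMA v:A. nbrs E V v)"
    using finAB dA fin by (simp add: finite_nbrs)
  also have "\<dots> \<le> card (SIGMA v:B. nbrs E V v)"
  proof (rule card_inj_on_le[of prod.swap])
    \<comment> \<open>Since \<open>A\<close> is independent, every arc leaving \<open>A\<close> ends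
      in \<open>B\<close>; its reversal is an arc leaving \<open>B\<close>.\<close>
    show "prod.swap ` (SIGMA v:A. nbrs E V v) \<subseteq> (SIGMA v:B. nbrs E V v)"
      using indep V \<open>sym E\<close> by (auto simp: nbrs_def dest: symD)
  qed (use finAB fin in \<open>auto simp: finite_nbrs\<close>)
  also have "\<dots> = (\<Sum>v\<in>B. ?d v)"
    using finAB fin by (simp add: finite_nbrs)
  finally have "2 * card A \<le> (\<Sum>v\<in>B. ?d v)" .
  moreover have "(\<Sum>v\<in>V. ?d v) = (\<Sum>v\<in>A. ?d v) + (\<Sum>v\<in>B. ?d v)" "card V = card A + card B"
    using V finAB by (metis sum.union_disjoint, metis card_Un_disjoint)
  moreover have "3 * (\<Sum>v\<in>V. ?d v) < 7 * card V"
    using sp ne by (auto simp: sparse_on_def card_arcs_eq_sum_degrees[OF fin, symmetric])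
  \<comment> \<open>Let a and b be the sizes of \<open>A\<close> and \<open>B\<close>, and s the
    degree sum over \<open>B\<close>. From 2a \<le> s and 3b \<le> s follows a + 7b \<le> (1/2 +
    7/3)s \<le> 3s, hence 7(a + b) \<le> 3(2a + s), against sparsity.\<close>
  ultimately show False
    using dA dB by linarith
qed

text \<open>The assumption \<open>deg\<close> forces a copy of \<open>C\<close> to use two edges at
  each of its vertices. Hence it avoids vertices of degree at most one and uses both edges at a
  vertex of degree two.\<close>

lemma sparse_on_orientation_avoiding:
  fixes C :: "('b \<times> 'b) set" and E :: "('a \<times> 'a) set"
  assumes "C \<noteq> {}" and walk: "C O C O C = {}"
    and deg: "\<And>c. c \<in> Field C \<Longrightarrow> \<exists>a b. a \<noteq> b \<and> (c, a) \<in> C \<union> C\<inverse> \<and> (c, b) \<in> C \<union> C\<inverse>"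
    and "finite V" "sym E" "irrefl E" "sparse_on E V"
  shows "\<exists>D. D \<inter> D\<inverse> = {} \<and> D \<union> D\<inverse> = E \<inter> V \<times> V \<and> \<not> embeds C D"
  using \<open>finite V\<close> \<open>sparse_on E V\<close>
proof (induction V rule: finite_psubset_induct)
  case (psubset V)
  note symE = symD[OF \<open>sym E\<close>]
  have irr: "(v, v) \<notin> E" for v
    using \<open>irrefl E\<close> by (simp add: irrefl_def)
  \<comment> \<open>This transfers \<open>deg\<close> to the host: injectivity keeps the images of
    the two neighbours distinct.\<close>
  have two_nbrs: "\<exists>a b. a \<noteq> b \<and> (c, a) \<in> C \<union> C\<inverse> \<and> (c, b) \<in> C \<union> C\<inverse> \<and> f a \<noteq> f b \<and>
      f a \<in> nbrs E V (f c) \<and> f b \<in> nbrs E V (f c)"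
    if c: "c \<in> Field C" and f: "inj_on f (Field C)" "\<And>u v. (u, v) \<in> C \<Longrightarrow> (f u, f v) \<in> D"
      and D: "D \<union> D\<inverse> = E \<inter> V \<times> V" for f c D
  proof -
    obtain a b where ab: "a \<noteq> b" "(c, a) \<in> C \<union> C\<inverse>" "(c, b) \<in> C \<union> C\<inverse>"
      using deg[OF c] by blast
    then have "a \<in> Field C" "b \<in> Field C"
      by (auto simp: Field_def)
    then have "f a \<noteq> f b"
      using ab(1) f(1) by (auto dest: inj_onD)
    moreover have "f x \<in> nbrs E V (f c)" if "(c, x) \<in> C \<union> C\<inverse>" for x
      using that f(2) D by (auto simp: nbrs_def)
    ultimately show ?thesis
      using ab by blast
  qed
  consider "V = {}" | v where "v \<in> V" "card (nbrs E V v) \<le> 1"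
    | a b where "a \<in> V" "b \<in> V" "(a, b) \<in> E" "card (nbrs E V a) = 2" "card (nbrs E V b) = 2"
    using sparse_on_reducible[OF psubset.hyps _ \<open>sym E\<close> psubset.prems] by blast
  then show ?case
  proof cases
    case 1
    then show ?thesis
      using \<open>C \<noteq> {}\<close> by (intro exI[of _ "{}"]) (auto simp: embeds_def)
  next
    case (2 v)
    obtain D' where D': "D' \<inter> D'\<inverse> = {}" "D' \<union> D'\<inverse> = E \<inter> (V - {v}) \<times> (V - {v})" "\<not> embeds C D'"
      using psubset.IH[of "V - {v}"] psubset.prems 2(1) sparse_on_subset[of E V "V - {v}"] by blast
    \<comment> \<open>The direction at \<open>v\<close> is arbitrary, because no copy can pass
      through \<open>v\<close>.\<close>
    define D where "D = D' \<union> {v} \<times> nbrs E V v"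
    have D: "D \<inter> D\<inverse> = {}" "D \<union> D\<inverse> = E \<inter> V \<times> V"
      using D'(1,2) 2(1) symE irr by (auto simp: D_def nbrs_def)
    have "\<not> embeds C D"
    proof
      assume "embeds C D"
      then obtain f where f: "inj_on f (Field C)" "\<And>u w. (u, w) \<in> C \<Longrightarrow> (f u, f w) \<in> D"
        by (auto simp: embeds_def)
      have "f c \<noteq> v" if c: "c \<in> Field C" for c
      proof
        assume "f c = v"
        then obtain x y where "x \<noteq> y" "x \<in> nbrs E V v" "y \<in> nbrs E V v"
          using two_nbrs[OF c f D(2)] by blast
        then show False
          using 2(2) finite_nbrs[OF psubset.hyps] by (auto simp: card_le_Suc0_iff_eq)
      qed
      then have "(f u, f w) \<in> D'" if "(u, w) \<in> C" for u w
        using f(2)[OF that] that by (auto simp: D_def Field_def)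
      then show False
        using D'(3) f(1) by (auto simp: embeds_def)
    qed
    with D show ?thesis
      by blast
  next
    case (3 a b)
    \<comment> \<open>Here \<open>x\<close> and \<open>y\<close> are the outer neighbours of
      \<open>a\<close> and \<open>b\<close>. They may coincide; then the three new arcs form a
      directed triangle, still without antiparallel arcs.\<close>
    obtain x where x: "nbrs E V a = {x, b}" "x \<noteq> b"
      using 3 by (auto simp: card_2_iff nbrs_def set_eq_iff; metis)
    obtain y where y: "nbrs E V b = {a, y}" "y \<noteq> a"
      using 3 symE[OF 3(3)] by (auto simp: card_2_iff nbrs_def set_eq_iff; metis)
    have ne: "a \<noteq> b" "x \<noteq> a" "y \<noteq> b"
      using 3(3) x y irr by (auto simp: nbrs_def)
    let ?W = "V - {a, b}"
    obtain D' where D': "D' \<inter> D'\<inverse> = {}" "D' \<union> D'\<inverse> = E \<inter> ?W \<times> ?W" "\<not> embeds C D'"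
      using psubset.IH[of ?W] psubset.prems 3(1) sparse_on_subset[of E V ?W] by blast
    define D where "D = D' \<union> {(x, a), (a, b), (b, y)}"
    have D'V: "u \<noteq> a \<and> u \<noteq> b \<and> w \<noteq> a \<and> w \<noteq> b" if "(u, w) \<in> D'" for u w
      using that D'(2) by blast
    have disj: "D \<inter> D\<inverse> = {}"
      using D'(1) D'V ne x(2) y(2) by (auto simp: D_def)
    have xy: "x \<in> V" "(a, x) \<in> E" "y \<in> V" "(b, y) \<in> E"
      using x y by (auto simp: nbrs_def)
    have arc_a: "(a, w) \<in> E \<and> w \<in> V \<longleftrightarrow> w = x \<or> w = b" for w
      using x by (auto simp: nbrs_def set_eq_iff)
    have arc_b: "(b, w) \<in> E \<and> w \<in> V \<longleftrightarrow> w = a \<or> w = y" for w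
      using y by (auto simp: nbrs_def set_eq_iff)
    have union: "D \<union> D\<inverse> = E \<inter> V \<times> V"
    proof
      show "D \<union> D\<inverse> \<subseteq> E \<inter> V \<times> V"
        using D'(2) xy 3 symE by (auto simp: D_def)
      show "E \<inter> V \<times> V \<subseteq> D \<union> D\<inverse>"
      proof (rule subrelI)
        fix u w assume "(u, w) \<in> E \<inter> V \<times> V"
        then have uw: "(u, w) \<in> E" "u \<in> V" "w \<in> V"
          by auto
        show "(u, w) \<in> D \<union> D\<inverse>"
        proof (cases "u \<in> {a, b} \<or> w \<in> {a, b}")
          case True
          then show ?thesis
            using uw arc_a[of u] arc_a[of w] arc_b[of u] arc_b[of w] symE[OF uw(1)]
            unfolding D_def by blast
        next
          case False
          then have "(u, w) \<in> D' \<union> D'\<inverse>"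
            using uw D'(2) by blast
          then show ?thesis
            by (auto simp: D_def)
        qed
      qed
    qed
    have "\<not> embeds C D"
    proof
      assume "embeds C D"
      then obtain f where f: "inj_on f (Field C)" "\<And>u w. (u, w) \<in> C \<Longrightarrow> (f u, f w) \<in> D"
        by (auto simp: embeds_def)
      note two = two_nbrs[OF _ f union]
      \<comment> \<open>As \<open>D\<close> has no antiparallel arcs, the direction of an arc of
        \<open>C\<close> can be read off from its image.\<close>
      have fwd: "(c, d) \<in> C" if "(c, d) \<in> C \<union> C\<inverse>" "(f c, f d) \<in> D" for c d
        using that f(2) disj by blast
      \<comment> \<open>The two neighbours of \<open>c\<close> must map onto both neighbours
        \<open>x\<close> and \<open>b\<close> of \<open>a\<close>, and the arcs (x, a) and (a, b) of
        \<open>D\<close> fix the directions in \<open>C\<close>.\<close>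
      have hit_a: "\<exists>p q. (p, c) \<in> C \<and> (c, q) \<in> C \<and> f p = x \<and> f q = b"
        if c: "c \<in> Field C" "f c = a" for c
      proof -
        obtain p q where "(c, p) \<in> C \<union> C\<inverse>" "(c, q) \<in> C \<union> C\<inverse>" "f p = x" "f q = b"
          using two[OF c(1)] x c(2) by (auto 4 3)
        then show ?thesis
          using fwd[of p c] fwd[of c q] c(2) by (auto simp: D_def)
      qed
      have hit_b: "\<exists>p q. (p, c) \<in> C \<and> (c, q) \<in> C \<and> f p = a \<and> f q = y"
        if c: "c \<in> Field C" "f c = b" for c
      proof -
        obtain p q where "(c, p) \<in> C \<union> C\<inverse>" "(c, q) \<in> C \<union> C\<inverse>" "f p = a" "f q = y"
          using two[OF c(1)] y c(2) by (auto 4 3)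
        then show ?thesis
          using fwd[of p c] fwd[of c q] c(2) by (auto simp: D_def)
      qed
      have not_b: "f c \<noteq> b" if "c \<in> Field C" for c
      proof
        assume "f c = b"
        then obtain p q where pq: "(p, c) \<in> C" "(c, q) \<in> C" "f p = a"
          using hit_b \<open>c \<in> Field C\<close> by blast
        \<comment> \<open>A copy through \<open>b\<close> also passes through \<open>a\<close>, the
          image of \<open>p\<close>. Then r, p, c, q is a walk with three arcs in \<open>C\<close>,
          which \<open>walk\<close> forbids.\<close>
        then obtain r where "(r, p) \<in> C"
          using hit_a[of p] by (auto simp: Field_def)
        then show False
          using pq walk by blast
      qed
      have not_a: "f c \<noteq> a" if "c \<in> Field C" for c
        using hit_a[OF that] not_b by (auto simp: Field_def)
      have "(f u, f w) \<in> D'" if "(u, w) \<in> C" for u w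
      proof -
        have "u \<in> Field C" "w \<in> Field C"
          using that by (auto simp: Field_def)
        then show ?thesis
          using f(2)[OF that] not_a not_b by (auto simp: D_def)
      qed
      then show False
        using D'(3) f(1) by (auto simp: embeds_def)
    qed
    with disj union show ?thesis
      by blast
  qed
qed

section \<open>From the maximum density to sparsity\<close>

lemma card_parcs_le: "finite (parcs G) \<Longrightarrow> card (parcs G) \<le> 2 * card (edges G)"
proof -
  assume fin: "finite (parcs G)"
  have E: "edges G = (\<lambda>(u, v). {u, v}) ` parcs G"
    by (auto simp: edges_def)
  then have finE: "finite (edges G)"
    using fin by simp
  have two: "finite {(a, b). {a, b} = X} \<and> card {(a, b). {a, b} = X} \<le> 2"
    if X_in: "X \<in> edges G" for X
  proof -
    obtain u v where X: "X = {u, v}"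
      using X_in unfolding edges_def by blast
    \<comment> \<open>An edge has at most two arcs above it, so the arcs split into fibres of size
      at most two.\<close>
    have "{(a, b). {a, b} = X} = {(u, v), (v, u)}"
      unfolding X doubleton_eq_iff by blast
    then show ?thesis
      using card_insert_le_m1[of 2 "{(v, u)}" "(u, v)"] by simp
  qed
  have "card (parcs G) \<le> card (\<Union>X\<in>edges G. {(a, b). {a, b} = X})"
  proof (rule card_mono)
    show "finite (\<Union>X\<in>edges G. {(a, b). {a, b} = X})"
      by (intro finite_UN_I finE conjunct1[OF two])
    show "parcs G \<subseteq> (\<Union>X\<in>edges G. {(a, b). {a, b} = X})"
      by (auto simp: E)
  qed
  also have "\<dots> \<le> (\<Sum>X\<in>edges G. card {(a, b). {a, b} = X})"
    by (rule card_UN_le[OF finE])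
  also have "\<dots> \<le> (\<Sum>X\<in>edges G. 2)"
    using two by (intro sum_mono) blast
  finally show ?thesis
    by simp
qed

lemma finite_subgraphs:
  assumes "pair_graph G"
  shows "finite (subgraphs G)"
proof -
  interpret pair_graph G by fact
  have "subgraphs G \<subseteq>
    (\<lambda>(V, A). \<lparr>pverts = V, parcs = A\<rparr>) ` (Pow (pverts G) \<times> Pow (parcs G))"
  proof
    fix J assume "J \<in> subgraphs G"
    then have "pverts J \<subseteq> pverts G" "parcs J \<subseteq> parcs G"
      by (auto simp: subgraphs_def subgraph_def)
    then show "J \<in> (\<lambda>(V, A). \<lparr>pverts = V, parcs = A\<rparr>) ` (Pow (pverts G) \<times> Pow (parcs G))"
      by (intro image_eqI[of _ _ "(pverts J, parcs J)"]) auto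
  qed
  then show ?thesis
    by (rule finite_subset) (simp add: pair_finite_verts pair_finite_arcs)
qed

lemma induced_in_subgraphs:
  assumes "pair_graph G" "W \<subseteq> pverts G"
  shows "\<lparr>pverts = W, parcs = parcs G \<inter> W \<times> W\<rparr> \<in> subgraphs G"
proof -
  interpret pair_graph G by fact
  let ?J = "\<lparr>pverts = W, parcs = parcs G \<inter> W \<times> W\<rparr>"
  have "sym (parcs G)"
    using pair_sym_arcs by (simp add: symmetric_def)
  then have s: "symmetric (with_proj ?J)"
    by (auto simp: symmetric_def sym_def)
  have J: "pair_graph ?J"
  proof
    show "finite (pverts ?J)"
      using assms(2) finite_subset[OF _ pair_finite_verts] by auto
  qed (use s pair_no_loops in \<open>auto simp: symmetric_def\<close>)
  then interpret J: pair_graph ?J .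
  show ?thesis
    using assms J J.wf_digraph_axioms wf_digraph_axioms
    by (auto simp: subgraphs_def subgraph_def compatible_def)
qed

text \<open>The induced subgraph on \<open>W\<close> competes in the maximum, so it has fewer than
  7/6 \<open>card W\<close> edges. Each edge accounts for at most two arcs, which turns 7/6 into
  7/3.\<close>

lemma sparse_on_if_max_density_less:
  assumes G: "pair_graph G" and "max_density G < 7 / 6"
  shows "sparse_on (parcs G) (pverts G)"
  unfolding sparse_on_def
proof (intro allI impI)
  interpret pair_graph G by fact
  fix W assume W: "W \<subseteq> pverts G" "W \<noteq> {}"
  let ?J = "\<lparr>pverts = W, parcs = parcs G \<inter> W \<times> W\<rparr>"
  have "finite W"
    using W finite_subset pair_finite_verts by blast
  then have W1: "card W \<ge> 1"
    using W by (simp add: Suc_le_eq card_gt_0_iff)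
  have "real (card (edges ?J)) / real (card W) \<le> max_density G"
    unfolding max_density_def
  proof (rule Max_ge)
    show "finite {real (card (edges J)) / real (card (pverts J)) | J.
        J \<in> subgraphs G \<and> card (pverts J) \<ge> 1}"
      using finite_subgraphs[OF G] by simp
  qed (use induced_in_subgraphs[OF G W(1)] W1 in force)
  then have "real (card (edges ?J)) \<le> max_density G * real (card W)"
    using W1 by (simp add: divide_le_eq)
  also have "\<dots> < 7 / 6 * real (card W)"
    using assms(2) W1 by (intro mult_strict_right_mono) simp_all
  finally have "real (card (edges ?J)) < 7 / 6 * real (card W)" .
  moreover have "card (parcs ?J) \<le> 2 * card (edges ?J)"
    using pair_finite_arcs by (intro card_parcs_le) simp
  ultimately show "3 * card (parcs G \<inter> W \<times> W) < 7 * card W"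
    by simp
qed

section \<open>The 2-density of a cycle\<close>

lemma card_edges_cycle_subgraph_le:
  assumes "J \<in> subgraphs (cycle_graph l)"
  shows "card (edges J) \<le> card {i \<in> pverts J. Suc i mod l \<in> pverts J}"
proof -
  interpret J: pair_graph J
    using assms by (simp add: subgraphs_def)
  have sub: "parcs J \<subseteq> parcs (cycle_graph l)"
    using assms by (auto simp: subgraphs_def subgraph_def)
  \<comment> \<open>Each edge is charged to the endpoint whose successor on the cycle is the other
    endpoint.\<close>
  have "edges J \<subseteq> (\<lambda>i. {i, Suc i mod l}) ` {i \<in> pverts J. Suc i mod l \<in> pverts J}"
  proof
    fix X assume "X \<in> edges J"
    then obtain u v where uv: "X = {u, v}" "(u, v) \<in> parcs J"
      by (auto simp: edges_def)
    then have "u \<in> pverts J" "v \<in> pverts J"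
      using J.arc_fst_in_verts J.arc_snd_in_verts by force+
    moreover have "v = Suc u mod l \<or> u = Suc v mod l"
      using uv(2) sub by (auto simp: cycle_graph_def)
    ultimately show "X \<in> (\<lambda>i. {i, Suc i mod l}) ` {i \<in> pverts J. Suc i mod l \<in> pverts J}"
      using uv(1) by (auto simp: insert_commute)
  qed
  then show ?thesis
    using J.pair_finite_verts by (intro surj_card_le) auto
qed

lemma cycle_closed_under_successor:
  assumes "W \<subseteq> {..<l}" "W \<noteq> {}" and suc: "\<And>i. i \<in> W \<Longrightarrow> Suc i mod l \<in> W"
  shows "W = {..<l}"
proof -
  obtain i where i: "i \<in> W" "i < l"
    using assms(1,2) by blast
  have shift: "(i + k) mod l \<in> W" for k
  proof (induction k)
    case (Suc k)
    then show ?case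
      using suc by (metis add_Suc_right mod_Suc_eq)
  qed (use i in simp)
  have "j \<in> W" if "j < l" for j
    \<comment> \<open>Going from \<open>i\<close> to \<open>l\<close> and on by \<open>j\<close>
      gives the index l + j, which is \<open>j\<close> modulo \<open>l\<close>.\<close>
    using shift[of "l - i + j"] that i by simp
  then show ?thesis
    using assms(1) by auto
qed

text \<open>On all \<open>l\<close> vertices the quotient is at most (l - 1)/(l - 2), which is at
  most 7/6 exactly from l = 8 on. A proper vertex subset is not closed under successor, so it spans
  fewer edges than vertices and the quotient is at most 1.\<close>

lemma max_2_density_cycle_graph_le:
  assumes l: "l \<ge> 8"
  shows "max_2_density (cycle_graph l) \<le> 7 / 6"
proof -
  have C: "pair_graph (cycle_graph l)"
    using l by (intro pair_graph_cycle_graph) simp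
  let ?S = "{(real (card (edges J)) - 1) / (real (card (pverts J)) - 2) | J.
     J \<in> subgraphs (cycle_graph l) \<and> card (pverts J) \<ge> 3}"
  have "finite ?S"
    using finite_subgraphs[OF C] by simp
  moreover have "?S \<noteq> {}"
  proof -
    have "card (pverts (cycle_graph l)) \<ge> 3"
      using l by (simp add: cycle_graph_def)
    then show ?thesis
      using induced_in_subgraphs[OF C order_refl] by force
  qed
  moreover have "(real (card (edges J)) - 1) / (real (card (pverts J)) - 2) \<le> 7 / 6"
    if J: "J \<in> subgraphs (cycle_graph l)" "card (pverts J) \<ge> 3" for J
  proof -
    let ?A = "{i \<in> pverts J. Suc i mod l \<in> pverts J}"
    have sub: "pverts J \<subseteq> {..<l}"
      using J by (auto simp: subgraphs_def subgraph_def cycle_graph_def)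
    then have fin: "finite (pverts J)"
      using finite_subset by blast
    have e: "card (edges J) \<le> card ?A"
      by (rule card_edges_cycle_subgraph_le[OF J(1)])
    show ?thesis
    proof (cases "pverts J = {..<l}")
      case True
      have "card ?A \<le> l"
        using card_mono[OF fin, of ?A] True by auto
      then show ?thesis
        using e l True by (simp add: field_simps)
    next
      case False
      then have "?A \<noteq> pverts J"
        using cycle_closed_under_successor[OF sub] J(2) by fastforce
      then have "card ?A < card (pverts J)"
        by (intro psubset_card_mono[OF fin]) blast
      then show ?thesis
        using e J(2) by (simp add: field_simps)
    qed
  qed
  ultimately show ?thesis
    unfolding max_2_density_def by (subst Max_le_iff) auto
qed

section \<open>Return to oriented graphs and conclusion\<close>

lemma cycle_graph_two_nbrs:
  assumes "l \<ge> 3" "i < l"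
  shows "\<exists>a b. a \<noteq> b \<and> (i, a) \<in> parcs (cycle_graph l) \<and> (i, b) \<in> parcs (cycle_graph l)"
proof (intro exI conjI)
  \<comment> \<open>This is the predecessor of \<open>i\<close> modulo \<open>l\<close>; for
    \<open>l\<close> at least 3 it differs from the successor.\<close>
  let ?p = "if i = 0 then l - 1 else i - 1"
  have "Suc ?p mod l = i" "?p < l"
    using assms by auto
  then show "(i, ?p) \<in> parcs (cycle_graph l)"
    unfolding cycle_graph_def pair_pre_digraph.simps by (intro UN_I[of ?p]) simp_all
  show "(i, Suc i mod l) \<in> parcs (cycle_graph l)"
    using assms by (auto simp: cycle_graph_def)
  show "?p \<noteq> Suc i mod l"
    using assms by (auto simp: mod_Suc)
qed

text \<open>An arc set on the vertices of \<open>G\<close> is packaged as a digraph whose symmetric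
  closure is \<open>G\<close>; a copy of \<open>C\<close> in it would restrict to an embedding on
  \<open>Field (parcs C)\<close>.\<close>

lemma not_arrows_if_not_embeds:
  assumes G: "pair_graph G" and C: "pair_wf_digraph C"
    and D: "D \<inter> D\<inverse> = {}" "D \<union> D\<inverse> = parcs G" "\<not> embeds (parcs C) D"
  shows "\<not> arrows G C"
proof
  interpret pair_graph G by fact
  let ?D = "\<lparr>pverts = pverts G, parcs = D\<rparr>"
  have sub: "D \<subseteq> parcs G"
    using D(2) by blast
  have "pair_digraph ?D"
  proof
    fix e assume "e \<in> parcs ?D"
    then have e: "e \<in> parcs G"
      using sub by auto
    show "fst e \<in> pverts ?D" "snd e \<in> pverts ?D" "fst e \<noteq> snd e"
      using arc_fst_in_verts[OF e] arc_snd_in_verts[OF e] pair_no_loops[OF e] by simp_all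
  qed (simp_all add: pair_finite_verts finite_subset[OF sub pair_finite_arcs])
  then interpret D: pair_digraph ?D .
  have "parcs (mk_symmetric (with_proj ?D)) = D \<union> D\<inverse>"
    by (force simp: parcs_mk_symmetric)
  then have "mk_symmetric (with_proj ?D) = G"
    by (simp add: D(2))
  then have "orientation_of ?D G"
    using \<open>pair_digraph ?D\<close> D(1) unfolding orientation_of_def oriented_graph_def by auto
  moreover assume "arrows G C"
  ultimately have "contains_copy ?D C"
    by (simp add: arrows_def)
  then obtain f where f: "inj_on f (pverts C)" "\<forall>(u, v) \<in> parcs C. (f u, f v) \<in> D"
    unfolding contains_copy_iff[OF D.pair_wf_digraph_axioms C] by auto
  have "Field (parcs C) \<subseteq> pverts C"
    using pair_wf_digraph.arc_fst_in_verts[OF C] pair_wf_digraph.arc_snd_in_verts[OF C]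
    by (force simp: Field_def)
  then show False
    using f D(3) inj_on_subset unfolding embeds_def by blast
qed

theorem theorem16:
  fixes l :: nat and C :: "nat pair_pre_digraph" and G :: "'a pair_pre_digraph"
  assumes "l \<ge> 8"
    and "orientation_of C (cycle_graph l)"
    and "pair_graph G"
    and "max_density G < max_2_density (mk_symmetric (with_proj C))"
  shows "\<not> arrows G C"
proof -
  interpret G: pair_graph G by fact
  have C: "mk_symmetric (with_proj C) = cycle_graph l" "pair_digraph C"
    using assms(2) by (auto simp: orientation_of_def oriented_graph_def)
  interpret C: pair_digraph C by fact
  have symC: "parcs (cycle_graph l) = parcs C \<union> (parcs C)\<inverse>"
    by (force simp: C(1)[symmetric] parcs_mk_symmetric)
  have "max_density G < 7 / 6"
    using assms(4) max_2_density_cycle_graph_le[OF assms(1)] C(1) by simp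
  then have sparse: "sparse_on (parcs G) (pverts G)"
    by (rule sparse_on_if_max_density_less[OF assms(3)])
  have G: "sym (parcs G)" "irrefl (parcs G)"
    using G.pair_sym_arcs G.pair_no_loops by (force simp: symmetric_def irrefl_def)+
  have GV: "parcs G \<inter> pverts G \<times> pverts G = parcs G"
    using G.arc_fst_in_verts G.arc_snd_in_verts by force
  have "\<exists>D. D \<inter> D\<inverse> = {} \<and> D \<union> D\<inverse> = parcs G \<and> \<not> embeds (parcs C) D"
  proof (cases "parcs C O parcs C O parcs C = {}")
    case True
    \<comment> \<open>Symmetric closure keeps the vertex set, so the vertices of \<open>C\<close>
      are those of the cycle.\<close>
    have "Field (parcs C) \<subseteq> {..<l}"
      using C.arc_fst_in_verts C.arc_snd_in_verts arg_cong[OF C(1), of pverts]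
      by (force simp: Field_def cycle_graph_def)
    then have deg: "\<exists>a b. a \<noteq> b \<and> (c, a) \<in> parcs C \<union> (parcs C)\<inverse> \<and> (c, b) \<in> parcs C \<union> (parcs C)\<inverse>"
      if "c \<in> Field (parcs C)" for c
      using cycle_graph_two_nbrs[of l c] that assms(1) unfolding symC by auto
    have "parcs C \<noteq> {}"
      using cycle_graph_two_nbrs[of l 0] assms(1) unfolding symC by auto
    then show ?thesis
      using sparse_on_orientation_avoiding[OF _ True deg G.pair_finite_verts G sparse]
      unfolding GV by blast
  next
    case False
    then obtain p q r s where walk: "(p, q) \<in> parcs C" "(q, r) \<in> parcs C" "(r, s) \<in> parcs C"
      by blast
    obtain f :: "'a \<Rightarrow> nat" where f: "\<And>v. f v < 3" "\<And>u v. (u, v) \<in> parcs G \<Longrightarrow> f u \<noteq> f v"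
      using sparse_on_three_colouring[OF G.pair_finite_verts G sparse] unfolding GV by blast
    let ?D = "{(u, v) \<in> parcs G. f u < f v}"
    have "\<not> embeds (parcs C) ?D"
    proof
      assume "embeds (parcs C) ?D"
      then obtain g where "\<And>u v. (u, v) \<in> parcs C \<Longrightarrow> f (g u) < f (g v)"
        by (auto simp: embeds_def)
      \<comment> \<open>The walk in \<open>C\<close> would need four strictly increasing colours,
        but only 0, 1 and 2 exist.\<close>
      then have "f (g p) < f (g q)" "f (g q) < f (g r)" "f (g r) < f (g s)"
        using walk by auto
      then show False
        using f(1)[of "g s"] by linarith
    qed
    moreover have "?D \<inter> ?D\<inverse> = {}"
      by auto
    moreover have "?D \<union> ?D\<inverse> = parcs G"
      using f(2) symD[OF G(1)] by (auto simp: neq_iff)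
    ultimately show ?thesis
      by (intro exI[of _ ?D] conjI)
  qed
  then show ?thesis
    using not_arrows_if_not_embeds[OF assms(3) C.pair_wf_digraph_axioms] by blast
qed

end
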